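(* Let $\alpha\colon\mathbb{R}\to\mathbb{R}$ be a discontinuous additive function, let $\kappa\in(0,1)$, and let $b,c,d$ be real numbers such that $$c>1,\quad 0<b\le d,\quad \frac{2}{1+\kappa}\le c\le\frac{2}{1-\kappa},\quad \frac{2b}{1+\kappa}\le d\le\frac{2b}{1-\kappa}.$$ Let $\lambda_\alpha\colon\mathbb{R}\to\mathbb{R}$ be defined by $$\lambda_\alpha(u):=\frac{|\alpha(u)|+b}{c|\alpha(u)|+d},\qquad u\in\mathbb{R}.$$ Then: (i) the functions $M,N\colon\mathbb{R}^2\to\mathbb{R}$ defined by $$M(u,v)=\lambda_\alpha(u)u+(1-\lambda_\alpha(u))v,\qquad N(u,v)=(1-\lambda_\alpha(u))u+\lambda_\alpha(u)v$$ are means in $\mathbb{R}$; (ii) the means $M,N$ are continuous only at the points of the diagonal $\Delta:=\{(x,x):x\in\mathbb{R}\}$ (that is, each of them is continuous at every point of $\Delta$ and discontinuous at every point of $\mathbb{R}^2\setminus\Delta$), and $$|M(u,v)-N(u,v)|\le\kappa|u-v|,\qquad u,v\in\mathbb{R};$$ (iii) the arithmetic mean $A\colon\mathbb{R}^2\to\mathbb{R}$, $A(u,v)=\frac{u+v}{2}$, is the unique $(M,N)$-invariant mean, and $\lim_{n\to\infty}(M,N)^n=(A,A)$ pointwise on $\mathbb{R}^2$.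
   Context: A function $\alpha\colon\mathbb{R}\to\mathbb{R}$ is additive if $\alpha(x+y)=\alpha(x)+\alpha(y)$ for all $x,y\in\mathbb{R}$. A function $M\colon\mathbb{R}^2\to\mathbb{R}$ is a mean in $\mathbb{R}$ if $\min(u,v)\le M(u,v)\le\max(u,v)$ for all $u,v\in\mathbb{R}$; means are not assumed continuous. For means $M,N$, the mapping $(M,N)\colon\mathbb{R}^2\to\mathbb{R}^2$ is $(u,v)\mapsto(M(u,v),N(u,v))$ and $(M,N)^n$ is its $n$-th iterate under composition. A mean $K\colon\mathbb{R}^2\to\mathbb{R}$ is $(M,N)$-invariant if $K\circ(M,N)=K$.
   Formalization: The discontinuity of M and N off the diagonal in (ii) is claimed only when d ≠ bc; if d = bc (e.g. κ = 1/2, b = 1, c = d = 2) then λ_α is the constant 1/c and M, N are continuous everywhere, so the claim fails there. *)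

theory Defs
  imports "HOL-Analysis.Analysis"
begin

definition is_mean :: "(real \<times> real \<Rightarrow> real) \<Rightarrow> bool" where
  "is_mean M \<longleftrightarrow> (\<forall>u v. min u v \<le> M (u, v) \<and> M (u, v) \<le> max u v)"

definition mean_map :: "(real \<times> real \<Rightarrow> real) \<Rightarrow> (real \<times> real \<Rightarrow> real) \<Rightarrow> real \<times> real \<Rightarrow> real \<times> real" where
  "mean_map M N = (\<lambda>p. (M p, N p))"

definition invariant_under ::
    "(real \<times> real \<Rightarrow> real) \<Rightarrow> (real \<times> real \<Rightarrow> real) \<Rightarrow> (real \<times> real \<Rightarrow> real) \<Rightarrow> bool" where
  "invariant_under M N K \<longleftrightarrow> K \<circ> mean_map M N = K"

definition arith_mean :: "real \<times> real \<Rightarrow> real" where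
  "arith_mean = (\<lambda>(u, v). (u + v) / 2)"

definition diagonal :: "(real \<times> real) set" where
  "diagonal = {(x, x) | x. True}"

(* Pitfall: if d = b * c, this is the constant function 1 / c, whatever \<alpha> is. *)
definition weight :: "(real \<Rightarrow> real) \<Rightarrow> real \<Rightarrow> real \<Rightarrow> real \<Rightarrow> real \<Rightarrow> real" where
  "weight \<alpha> b c d u = (\<bar>\<alpha> u\<bar> + b) / (c * \<bar>\<alpha> u\<bar> + d)"

end

theory Submission
  imports Defs
begin

text \<open>
  The bounds on c and d force the weight \<lambda> to take its values in the
  interval [(1 - \<kappa>) / 2, (1 + \<kappa>) / 2]: the numerator is compared with the denominator
  coefficient by coefficient. Hence M and N are convex combinations, M + N = u + v, and
  M - N = (2\<lambda> - 1)(u - v) contracts by the factor \<kappa>. So the iterates of (M, N) keep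
  the arithmetic mean and squeeze the two coordinates together geometrically, which gives
  the limit. An invariant mean is constant along the iterates, and at their limit on the diagonal it
  is continuous and has no choice of value; this gives uniqueness.

  Continuity on the diagonal holds for every mean, by squeezing between min and max. Off the
  diagonal \<lambda> can be recovered from M by division, so continuity of M or N at (u, v)
  forces continuity of \<lambda> at u. The identity 1/c - \<lambda> = (d - bc) / (c (c \<bar>\<alpha>\<bar> + d)) shows that the
  value 1/c, which \<lambda> approaches only where \<bar>\<alpha>\<bar> is large, is never attained
  if d \<noteq> bc. Continuity of \<lambda> at u would therefore keep it away from 1/c near u and so
  bound \<alpha> near u, and an additive function bounded near one point is continuous.
\<close>

section \<open>Locally bounded additive functions\<close>

lemma additive_of_nat_mult:
  fixes f :: "real \<Rightarrow> real"
  assumes "Modules.additive f"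
  shows "f (real n * x) = real n * f x"
proof -
  interpret additive f by fact
  show ?thesis
    by (induction n) (simp_all add: zero add algebra_simps)
qed

text \<open>
  Translation moves the bound to a neighbourhood of 0, where rational homogeneity improves it: a
  bound C for \<bar>y\<bar> < \<delta> becomes C / n for \<bar>y\<bar> < \<delta> / n. So the function is continuous at 0,
  and by translation everywhere.
\<close>
lemma additive_bounded_near_imp_continuous:
  fixes f :: "real \<Rightarrow> real"
  assumes f: "Modules.additive f"
    and bounded: "\<forall>\<^sub>F x in nhds u. \<bar>f x\<bar> \<le> B"
  shows "continuous_on UNIV f"
proof -
  interpret additive f by (rule f)
  obtain \<delta> where "\<delta> > 0" and \<delta>: "\<And>x. dist x u < \<delta> \<Longrightarrow> \<bar>f x\<bar> \<le> B"
    using bounded unfolding eventually_nhds_metric by auto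
  define C where "C = B + \<bar>f u\<bar>"
  have C: "\<bar>f h\<bar> \<le> C" if "\<bar>h\<bar> < \<delta>" for h
    using \<delta>[of "u + h"] that by (simp add: dist_real_def add C_def)
  have "\<exists>\<eta>>0. \<forall>y. dist y x < \<eta> \<longrightarrow> dist (f y) (f x) < \<epsilon>" if "\<epsilon> > 0" for x \<epsilon>
  proof -
    obtain n :: nat where n: "C / \<epsilon> < real n"
      using reals_Archimedean2 by blast
    have "0 \<le> C"
      using C[of 0] \<open>\<delta> > 0\<close> by simp
    then have "n > 0"
      using n \<open>\<epsilon> > 0\<close> by (cases n) (auto simp: divide_less_0_iff)
    have "dist (f y) (f x) < \<epsilon>" if "dist y x < \<delta> / real n" for y
    proof -
      have "\<bar>real n * (y - x)\<bar> < \<delta>"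
        unfolding abs_mult using that \<open>n > 0\<close>
        by (simp add: dist_real_def pos_less_divide_eq mult.commute)
      then have "real n * \<bar>f (y - x)\<bar> \<le> C"
        using C[of "real n * (y - x)"] additive_of_nat_mult[OF f, of n "y - x"]
        by (simp add: abs_mult)
      also have "C < real n * \<epsilon>"
        using n \<open>\<epsilon> > 0\<close> by (simp add: field_simps)
      finally show ?thesis
        using \<open>n > 0\<close> by (simp add: dist_real_def diff)
    qed
    with \<open>\<delta> > 0\<close> \<open>n > 0\<close> show ?thesis
      by (intro exI[of _ "\<delta> / real n"]) simp
  qed
  then show ?thesis
    by (auto simp: continuous_on_iff)
qed

section \<open>The weight\<close>

lemma weight_bounds:
  assumes "0 < \<kappa>" "\<kappa> < 1" "c > 1" "0 < b" "b \<le> d"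
    and "2 / (1 + \<kappa>) \<le> c" "c \<le> 2 / (1 - \<kappa>)"
    and "2 * b / (1 + \<kappa>) \<le> d" "d \<le> 2 * b / (1 - \<kappa>)"
  shows "(1 - \<kappa>) / 2 \<le> weight \<alpha> b c d u" and "weight \<alpha> b c d u \<le> (1 + \<kappa>) / 2"
proof -
  define t where "t = \<bar>\<alpha> u\<bar>"
  have "t \<ge> 0"
    by (simp add: t_def)
  have pos: "c * t + d > 0"
    using assms \<open>t \<ge> 0\<close> by (intro add_nonneg_pos) auto
  have coeffs: "(1 - \<kappa>) * c \<le> 2" "2 \<le> (1 + \<kappa>) * c" "(1 - \<kappa>) * d \<le> 2 * b" "2 * b \<le> (1 + \<kappa>) * d"
    using assms by (simp_all add: field_simps)
  have "(1 - \<kappa>) * (c * t + d) \<le> 2 * (t + b)"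
    using mult_right_mono[OF coeffs(1) \<open>t \<ge> 0\<close>] coeffs(3) by (simp add: algebra_simps)
  then show "(1 - \<kappa>) / 2 \<le> weight \<alpha> b c d u"
    using pos by (simp add: weight_def flip: t_def) (simp add: field_simps)
  have "2 * (t + b) \<le> (1 + \<kappa>) * (c * t + d)"
    using mult_right_mono[OF coeffs(2) \<open>t \<ge> 0\<close>] coeffs(4) by (simp add: algebra_simps)
  then show "weight \<alpha> b c d u \<le> (1 + \<kappa>) / 2"
    using pos by (simp add: weight_def flip: t_def) (simp add: field_simps)
qed

text \<open>
  The distance of the weight from 1/c is inversely proportional to \<open>c * \<bar>\<alpha> x\<bar> + d\<close>. Continuity at
  u bounds it below near u, hence bounds \<alpha> above there.
\<close>
lemma isCont_weight_imp_continuous: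
  fixes \<alpha> :: "real \<Rightarrow> real"
  assumes add: "Modules.additive \<alpha>" and "c > 0" "d > 0" "d \<noteq> b * c"
    and cont: "isCont (weight \<alpha> b c d) u"
  shows "continuous_on UNIV \<alpha>"
proof -
  define g where "g x = \<bar>1 / c - weight \<alpha> b c d x\<bar>" for x
  have pos: "c * \<bar>\<alpha> x\<bar> + d > 0" for x
    using \<open>c > 0\<close> \<open>d > 0\<close> by (intro add_nonneg_pos) auto
  have g: "g x = \<bar>d - b * c\<bar> / (c * (c * \<bar>\<alpha> x\<bar> + d))" for x
  proof -
    have "1 / c - weight \<alpha> b c d x = (d - b * c) / (c * (c * \<bar>\<alpha> x\<bar> + d))"
      using pos[of x] \<open>c > 0\<close> by (simp add: weight_def divide_simps) (simp add: algebra_simps)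
    then show ?thesis
      using pos[of x] \<open>c > 0\<close> by (simp add: g_def abs_divide abs_mult)
  qed
  have "g u > 0"
    using pos[of u] \<open>c > 0\<close> \<open>d \<noteq> b * c\<close> by (simp add: g)
  define B where "B = \<bar>d - b * c\<bar> / (c * c * (g u / 2))"
  have "isCont g u"
    unfolding g_def by (intro continuous_intros cont)
  then have "(g \<longlongrightarrow> g u) (nhds u)"
    by (simp add: continuous_within tendsto_at_iff_tendsto_nhds)
  then have "\<forall>\<^sub>F x in nhds u. g x > g u / 2"
    using \<open>g u > 0\<close> by (intro order_tendstoD(1)) auto
  then have "\<forall>\<^sub>F x in nhds u. \<bar>\<alpha> x\<bar> \<le> B"
  proof eventually_elim
    case (elim x)
    have "g u / 2 * (c * (c * \<bar>\<alpha> x\<bar> + d)) < \<bar>d - b * c\<bar>"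
      using elim pos[of x] \<open>c > 0\<close> by (simp add: g pos_less_divide_eq)
    moreover have "g u / 2 * (c * (c * \<bar>\<alpha> x\<bar>)) \<le> g u / 2 * (c * (c * \<bar>\<alpha> x\<bar> + d))"
      using \<open>g u > 0\<close> \<open>c > 0\<close> \<open>d > 0\<close> by (intro mult_left_mono) auto
    ultimately have "\<bar>\<alpha> x\<bar> * (c * c * (g u / 2)) \<le> \<bar>d - b * c\<bar>"
      by (simp add: algebra_simps)
    then show ?case
      using \<open>g u > 0\<close> \<open>c > 0\<close> by (simp add: B_def pos_le_divide_eq)
  qed
  with add show ?thesis
    by (rule additive_bounded_near_imp_continuous)
qed

section \<open>Means and their continuity\<close>

lemma convex_combination_between:
  fixes t u v :: real
  assumes "0 \<le> t" "t \<le> 1"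
  shows "min u v \<le> t * u + (1 - t) * v" "t * u + (1 - t) * v \<le> max u v"
proof -
  have "t * min u v + (1 - t) * min u v \<le> t * u + (1 - t) * v"
    using assms by (intro add_mono mult_left_mono) auto
  then show "min u v \<le> t * u + (1 - t) * v"
    by (simp add: algebra_simps)
  have "t * u + (1 - t) * v \<le> t * max u v + (1 - t) * max u v"
    using assms by (intro add_mono mult_left_mono) auto
  then show "t * u + (1 - t) * v \<le> max u v"
    by (simp add: algebra_simps)
qed

lemma is_mean_convex_combination:
  assumes "\<And>u v. M (u, v) = w u * u + (1 - w u) * v"
    and "\<And>u. 0 \<le> w u" "\<And>u. w u \<le> 1"
  shows "is_mean M"
  using assms(2,3) by (simp add: is_mean_def assms(1) convex_combination_between)

text \<open>At (x, x) both min and max equal x, and they are continuous.\<close>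
lemma is_mean_isCont_diagonal:
  assumes "is_mean M" and "p \<in> diagonal"
  shows "isCont M p"
proof -
  have bounds: "min (fst q) (snd q) \<le> M q" "M q \<le> max (fst q) (snd q)" for q
    using assms(1) by (cases q; simp add: is_mean_def)+
  obtain x where p: "p = (x, x)"
    using assms(2) by (auto simp: diagonal_def)
  have "M p = x"
    using bounds[of p] p by simp
  have "((\<lambda>q. min (fst q) (snd q)) \<longlongrightarrow> min (fst p) (snd p)) (at p)"
       "((\<lambda>q. max (fst q) (snd q)) \<longlongrightarrow> max (fst p) (snd p)) (at p)"
    by (intro tendsto_intros)+
  then have "(M \<longlongrightarrow> x) (at p)"
    by (intro tendsto_sandwich[of "\<lambda>q. min (fst q) (snd q)" M "at p" "\<lambda>q. max (fst q) (snd q)"])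
       (simp_all add: bounds p)
  then show ?thesis
    by (simp add: isCont_def \<open>M p = x\<close>)
qed

text \<open>For x \<noteq> v the weight is the difference quotient (M(x, v) - v) / (x - v).\<close>
lemma isCont_convex_combination_imp_isCont_weight:
  fixes M :: "real \<times> real \<Rightarrow> real"
  assumes M: "\<And>u v. M (u, v) = w u * u + (1 - w u) * v"
    and cont: "isCont M (u, v)" and "u \<noteq> v"
  shows "isCont w u"
proof -
  have "isCont (\<lambda>x. M (x, v)) u"
    using isCont_o2[of u "\<lambda>x. (x, v)" M] cont by simp
  then have "isCont (\<lambda>x. (M (x, v) - v) / (x - v)) u"
    using \<open>u \<noteq> v\<close> by (intro continuous_intros) auto
  moreover have "\<forall>\<^sub>F x in nhds u. (M (x, v) - v) / (x - v) = w x"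
    using t1_space_nhds[OF \<open>u \<noteq> v\<close>]
    by eventually_elim (simp add: M field_simps)
  ultimately show ?thesis
    by (simp add: isCont_cong)
qed

section \<open>Iteration of contracting pairs that preserve the sum\<close>

lemma is_mean_arith_mean: "is_mean arith_mean"
  by (auto simp: is_mean_def arith_mean_def)

lemma invariant_under_arith_mean:
  assumes "\<And>u v. M (u, v) + N (u, v) = u + v"
  shows "invariant_under M N arith_mean"
  by (auto simp: invariant_under_def mean_map_def arith_mean_def assms)

lemma invariant_under_funpow:
  assumes "invariant_under M N K"
  shows "K ((mean_map M N ^^ n) p) = K p"
proof (induction n)
  case (Suc n)
  have "K (mean_map M N q) = K q" for q
    using fun_cong[OF assms[unfolded invariant_under_def], of q] by simp
  with Suc show ?case
    by simp
qed simp

lemma mean_map_funpow_contracts: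
  fixes \<kappa> :: real
  assumes "0 \<le> \<kappa>"
    and contr: "\<And>u v. \<bar>M (u, v) - N (u, v)\<bar> \<le> \<kappa> * \<bar>u - v\<bar>"
  shows "\<bar>fst ((mean_map M N ^^ n) p) - snd ((mean_map M N ^^ n) p)\<bar> \<le> \<kappa> ^ n * \<bar>fst p - snd p\<bar>"
proof (induction n)
  case (Suc n)
  obtain u v where q: "(mean_map M N ^^ n) p = (u, v)"
    by fastforce
  have "\<bar>M (u, v) - N (u, v)\<bar> \<le> \<kappa> * \<bar>u - v\<bar>"
    by (rule contr)
  also have "\<dots> \<le> \<kappa> * (\<kappa> ^ n * \<bar>fst p - snd p\<bar>)"
    using Suc q \<open>0 \<le> \<kappa>\<close> by (intro mult_left_mono) auto
  finally have "\<bar>M (u, v) - N (u, v)\<bar> \<le> \<kappa> ^ Suc n * \<bar>fst p - snd p\<bar>"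
    by (simp add: mult.assoc)
  moreover have "(mean_map M N ^^ Suc n) p = (M (u, v), N (u, v))"
    using q by (simp add: mean_map_def[of M N, THEN fun_cong])
  ultimately show ?case
    by simp
qed simp

lemma mean_map_funpow_tendsto_arith_mean:
  fixes \<kappa> :: real
  assumes "0 \<le> \<kappa>" "\<kappa> < 1"
    and sum: "\<And>u v. M (u, v) + N (u, v) = u + v"
    and contr: "\<And>u v. \<bar>M (u, v) - N (u, v)\<bar> \<le> \<kappa> * \<bar>u - v\<bar>"
  shows "(\<lambda>n. (mean_map M N ^^ n) p) \<longlonglongrightarrow> (arith_mean p, arith_mean p)"
proof -
  define q where "q n = (mean_map M N ^^ n) p" for n
  define D where "D = \<bar>fst p - snd p\<bar>"
  have "(\<lambda>n. \<kappa> ^ n * D) \<longlonglongrightarrow> 0 * D"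
    using assms by (intro tendsto_intros LIMSEQ_realpow_zero)
  then have "(\<lambda>n. \<kappa> ^ n * D) \<longlonglongrightarrow> 0"
    by simp
  moreover have "\<forall>\<^sub>F n in sequentially. norm (fst (q n) - snd (q n)) \<le> \<kappa> ^ n * D"
    using mean_map_funpow_contracts[of \<kappa> M N, OF \<open>0 \<le> \<kappa>\<close> contr] by (simp add: q_def D_def)
  ultimately have gap: "(\<lambda>n. fst (q n) - snd (q n)) \<longlonglongrightarrow> 0"
    by (rule Lim_null_comparison[rotated])
  have "arith_mean (q n) = arith_mean p" for n
    unfolding q_def by (intro invariant_under_funpow invariant_under_arith_mean sum)
  then have "fst (q n) + snd (q n) = 2 * arith_mean p" for n
    by (simp add: arith_mean_def case_prod_beta)
  \<comment> \<open>Each coordinate is the conserved mean plus or minus half the gap.\<close>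
  then have fst_eq: "fst (q n) = arith_mean p + (fst (q n) - snd (q n)) / 2"
    and snd_eq: "snd (q n) = arith_mean p - (fst (q n) - snd (q n)) / 2" for n
    by (simp_all add: field_simps)
  have "(\<lambda>n. arith_mean p + (fst (q n) - snd (q n)) / 2) \<longlonglongrightarrow> arith_mean p + 0 / 2"
       "(\<lambda>n. arith_mean p - (fst (q n) - snd (q n)) / 2) \<longlonglongrightarrow> arith_mean p - 0 / 2"
    by (intro tendsto_intros gap; simp)+
  then have "(\<lambda>n. fst (q n)) \<longlonglongrightarrow> arith_mean p" "(\<lambda>n. snd (q n)) \<longlonglongrightarrow> arith_mean p"
    by (simp_all flip: fst_eq snd_eq)
  then have "(\<lambda>n. (fst (q n), snd (q n))) \<longlonglongrightarrow> (arith_mean p, arith_mean p)"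
    by (rule tendsto_Pair)
  then show ?thesis
    by (simp add: q_def)
qed

text \<open>
  K is constant along the iterates of (M, N), which converge to a diagonal point; every mean is
  continuous there and takes the value of the common coordinate.
\<close>
lemma invariant_mean_unique:
  assumes "is_mean K" "invariant_under M N K"
    and lim: "\<And>p. (\<lambda>n. (mean_map M N ^^ n) p) \<longlonglongrightarrow> (L p, L p)"
  shows "K = L"
proof
  fix p
  have "isCont K (L p, L p)"
    using assms(1) by (rule is_mean_isCont_diagonal) (simp add: diagonal_def)
  then have "(\<lambda>n. K ((mean_map M N ^^ n) p)) \<longlonglongrightarrow> K (L p, L p)"
    using lim by (rule isCont_tendsto_compose)
  then have "K p = K (L p, L p)"
    using invariant_under_funpow[OF assms(2)] by (simp add: LIMSEQ_const_iff)
  also have "\<dots> = L p"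
    using assms(1) by (metis is_mean_def max.idem min.idem order_antisym)
  finally show "K p = L p" .
qed

section \<open>The weighted means of a discontinuous additive function\<close>

theorem proposition2:
  fixes \<alpha> :: "real \<Rightarrow> real" and \<kappa> b c d :: real
    and M N :: "real \<times> real \<Rightarrow> real"
  assumes "Modules.additive \<alpha>" and "\<not> continuous_on UNIV \<alpha>"
    and "0 < \<kappa>" and "\<kappa> < 1"
    and "c > 1" and "0 < b" and "b \<le> d"
    and "2 / (1 + \<kappa>) \<le> c" and "c \<le> 2 / (1 - \<kappa>)"
    and "2 * b / (1 + \<kappa>) \<le> d" and "d \<le> 2 * b / (1 - \<kappa>)"
    and M: "\<And>u v. M (u, v) = weight \<alpha> b c d u * u + (1 - weight \<alpha> b c d u) * v"
    and N: "\<And>u v. N (u, v) = (1 - weight \<alpha> b c d u) * u + weight \<alpha> b c d u * v"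
  shows "(is_mean M \<and> is_mean N) \<and>
    ((\<forall>p \<in> diagonal. isCont M p \<and> isCont N p) \<and>
     (d \<noteq> b * c \<longrightarrow> (\<forall>p \<in> UNIV - diagonal. \<not> isCont M p \<and> \<not> isCont N p)) \<and>
     (\<forall>u v. \<bar>M (u, v) - N (u, v)\<bar> \<le> \<kappa> * \<bar>u - v\<bar>)) \<and>
    (is_mean arith_mean \<and> invariant_under M N arith_mean \<and>
     (\<forall>K. is_mean K \<and> invariant_under M N K \<longrightarrow> K = arith_mean) \<and>
     (\<forall>p. (\<lambda>n. (mean_map M N ^^ n) p) \<longlonglongrightarrow> (arith_mean p, arith_mean p)))"
proof -
  define w where "w = weight \<alpha> b c d"
  have M': "\<And>u v. M (u, v) = w u * u + (1 - w u) * v"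
    using M by (simp add: w_def)
  \<comment> \<open>Written this way, N is the same construction as M with weight 1 - w.\<close>
  have N': "\<And>u v. N (u, v) = (1 - w u) * u + (1 - (1 - w u)) * v"
    using N by (simp add: w_def)
  have w: "(1 - \<kappa>) / 2 \<le> w u" "w u \<le> (1 + \<kappa>) / 2" for u
    unfolding w_def by (rule weight_bounds; fact)+
  have w01: "0 \<le> w u" "w u \<le> 1" for u
    using w[of u] \<open>0 < \<kappa>\<close> \<open>\<kappa> < 1\<close> by (simp_all add: field_simps)
  have means: "is_mean M" "is_mean N"
    by (rule is_mean_convex_combination, rule M' N', use w01 in simp_all)+
  have sum: "M (u, v) + N (u, v) = u + v" for u v
    by (simp add: M' N' algebra_simps)
  have contr: "\<bar>M (u, v) - N (u, v)\<bar> \<le> \<kappa> * \<bar>u - v\<bar>" for u v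
  proof -
    have "M (u, v) - N (u, v) = (2 * w u - 1) * (u - v)"
      by (simp add: M' N' algebra_simps)
    moreover have "\<bar>2 * w u - 1\<bar> \<le> \<kappa>"
      using w[of u] by (simp add: abs_le_iff field_simps)
    ultimately show ?thesis
      by (simp add: abs_mult mult_right_mono)
  qed
  have off_diagonal: "\<not> isCont M p \<and> \<not> isCont N p" if "d \<noteq> b * c" "p \<notin> diagonal" for p
  proof -
    obtain u v where p: "p = (u, v)" "u \<noteq> v"
      using \<open>p \<notin> diagonal\<close> by (cases p) (auto simp: diagonal_def)
    have "\<not> isCont w u"
      using isCont_weight_imp_continuous[OF assms(1), of c d b u] assms(2,5-7) \<open>d \<noteq> b * c\<close>
      by (auto simp: w_def)
    then have "\<not> isCont M p" "\<not> isCont (\<lambda>x. 1 - (1 - w x)) u"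
      using isCont_convex_combination_imp_isCont_weight[OF M'] p by auto
    moreover have "isCont (\<lambda>x. 1 - w x) u" if "isCont N p"
      using isCont_convex_combination_imp_isCont_weight[of N "\<lambda>x. 1 - w x", OF N'] that p by auto
    ultimately show ?thesis
      using continuous_diff[OF continuous_const, of "at u" "\<lambda>x. 1 - w x" 1] by auto
  qed
  have lim: "(\<lambda>n. (mean_map M N ^^ n) p) \<longlonglongrightarrow> (arith_mean p, arith_mean p)" for p
    using \<open>0 < \<kappa>\<close> \<open>\<kappa> < 1\<close> sum contr
    by (intro mean_map_funpow_tendsto_arith_mean[of \<kappa>]) auto
  have "\<forall>p \<in> diagonal. isCont M p \<and> isCont N p"
    using means by (simp add: is_mean_isCont_diagonal)
  moreover have "\<forall>K. is_mean K \<and> invariant_under M N K \<longrightarrow> K = arith_mean"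
    using invariant_mean_unique[OF _ _ lim] by blast
  ultimately show ?thesis
    using means off_diagonal contr lim is_mean_arith_mean
      invariant_under_arith_mean[of M N, OF sum]
    by blast
qed

end
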